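(* Let $A$ be any envy-free pricing mechanism. For every market with true valuations $\mathbf{v}$, the best response dynamic starting from the truth-telling profile $\mathbf{v}$ converges to a pure Nash equilibrium of $A$. Compared to the truth-telling outcome (the outcome of $A$ on $\mathbf{v}$), the equilibrium reached has the property that: (i) the utility of each buyer is (weakly) higher; and (ii) the number of units received by each buyer is (weakly) larger, possibly with the exception of the last deviator (the buyer who made the last move of the dynamic). Moreover, the best response dynamic may cycle when starting from a non-truthful profile; that is, there exist an envy-free pricing mechanism, a market, and a non-truthful starting profile from which a sequence of best responses returns to the starting profile.
   Context: Market: a linear multi-unit market $\mathcal{M}=(\mathbf{v},\mathbf{B},m)$ has buyers $N=\{1,\dots,n\}$ and one seller with $m$ indivisible identical units. Buyer $i$ has budget $B_i>0$ and per-unit valuation $v_i$. The utility of buyer $i$ for $k$ units at unit price $p$ is $u_i(p,k)=v_ik-pk$ if $pk\le B_i$ and $-\infty$ otherwise. The demand set $D_i(p)$ is $\{\min\{\lfloor B_i/p\rfloor,m\}\}$ if $v_i>p$; $\{0,1,\dots,\min\{\lfloor B_i/p\rfloor,m\}\}$ if $v_i=p$; and $\{0\}$ if $v_i<p$. An outcome $(\mathbf{x},p)$ with $x_i\in\mathbb{Z}_{\ge 0}$ and $\sum_i x_i\le m$ is an envy-free pricing if $x_i\in D_i(p)$ for all $i$; price $0$ is not regarded as an envy-free price. Discrete domain: valuations, reports and budgets lie in $\mathbb{V}=\{k\epsilon: k\in\mathbb{N}\}$ for some fixed $\epsilon>0$, and prices are chosen from $\mathbb{W}=\{k\delta:k\in\mathbb{N}\}$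 for some fixed $\delta>0$. Mechanism: an envy-free pricing mechanism $A$ maps each market (reported valuations, known budgets $\mathbf{B}$, known $m$) to an envy-free pricing $(\mathbf{x},p)$ with respect to the reported valuations. Budgets and $m$ are known; valuations are private, and a strategy of buyer $i$ is a reported valuation $s_i\in\mathbb{V}$. Buyer $i$'s utility at a profile $\mathbf{s}$ is computed with its true valuation $v_i$ and the outcome of $A$ on $\mathbf{s}$. A profile $\mathbf{s}$ is a pure Nash equilibrium if no buyer can strictly improve its utility by changing its own report. Best response dynamic: starting from an initial profile, at each step some buyer (in arbitrary order) who can strictly improve its utility changes its report to one maximizing its utility given the current reports of the others. The dynamic converges if after finitely many steps no buyer can strictly improve. *)

theory Defs
  imports Complex_Main "HOL-Library.Extended_Real"
begin

text \<open>
  A market is given by a list \<open>v\<close> of valuations, a list \<open>B\<close> of budgets and the number \<open>m\<close> of units.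
  Buyers are the indices \<open>i < length v\<close>. An outcome is a pair \<open>(x, p)\<close> of an allocation and a unit price.
\<close>

type_synonym outcome = "nat list \<times> real"
type_synonym mechanism = "real list \<Rightarrow> real list \<Rightarrow> nat \<Rightarrow> outcome"

definition grid :: "real \<Rightarrow> real set" where
  "grid e = {real k * e | k :: nat. True}"

definition is_market :: "real \<Rightarrow> real list \<Rightarrow> real list \<Rightarrow> bool" where
  "is_market \<epsilon> v B \<longleftrightarrow>
     length v = length B \<and> set v \<subseteq> grid \<epsilon> \<and> set B \<subseteq> grid \<epsilon> \<and> (\<forall>b\<in>set B. b > 0)"

definition utility :: "real \<Rightarrow> real \<Rightarrow> real \<Rightarrow> nat \<Rightarrow> ereal" where
  "utility v b p k = (if p * real k \<le> b then ereal (v * real k - p * real k) else -\<infinity>)"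

text \<open>Only used for \<open>p > 0\<close> and \<open>b > 0\<close>, where \<open>nat\<close> does not truncate.\<close>

definition demand :: "real \<Rightarrow> real \<Rightarrow> nat \<Rightarrow> real \<Rightarrow> nat set" where
  "demand v b m p =
     (if v > p then {min (nat \<lfloor>b / p\<rfloor>) m}
      else if v = p then {0..min (nat \<lfloor>b / p\<rfloor>) m}
      else {0})"

definition envy_free_pricing :: "real list \<Rightarrow> real list \<Rightarrow> nat \<Rightarrow> outcome \<Rightarrow> bool" where
  "envy_free_pricing v B m = (\<lambda>(x, p).
     p > 0 \<and> length x = length v \<and> sum_list x \<le> m \<and>
     (\<forall>i<length v. x ! i \<in> demand (v ! i) (B ! i) m p))"

definition envy_free_mechanism :: "real \<Rightarrow> real \<Rightarrow> mechanism \<Rightarrow> bool" where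
  "envy_free_mechanism \<epsilon> \<delta> A \<longleftrightarrow>
     (\<forall>s B m. is_market \<epsilon> s B \<longrightarrow>
        envy_free_pricing s B m (A s B m) \<and> snd (A s B m) \<in> grid \<delta>)"

text \<open>
  In the following, \<open>v\<close> are the true valuations and \<open>s\<close> is the profile of reports: the outcome is
  computed from \<open>s\<close>, its utility from \<open>v\<close>.
\<close>

definition units :: "mechanism \<Rightarrow> real list \<Rightarrow> nat \<Rightarrow> real list \<Rightarrow> nat \<Rightarrow> nat" where
  "units A B m s i = fst (A s B m) ! i"

definition buyer_utility ::
  "mechanism \<Rightarrow> real list \<Rightarrow> real list \<Rightarrow> nat \<Rightarrow> real list \<Rightarrow> nat \<Rightarrow> ereal" where
  "buyer_utility A v B m s i = utility (v ! i) (B ! i) (snd (A s B m)) (units A B m s i)"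

definition is_profile :: "real \<Rightarrow> real list \<Rightarrow> real list \<Rightarrow> bool" where
  "is_profile \<epsilon> v s \<longleftrightarrow> length s = length v \<and> set s \<subseteq> grid \<epsilon>"

definition can_improve ::
  "real \<Rightarrow> mechanism \<Rightarrow> real list \<Rightarrow> real list \<Rightarrow> nat \<Rightarrow> real list \<Rightarrow> nat \<Rightarrow> bool" where
  "can_improve \<epsilon> A v B m s i \<longleftrightarrow>
     (\<exists>r\<in>grid \<epsilon>. buyer_utility A v B m (s[i := r]) i > buyer_utility A v B m s i)"

definition pure_nash ::
  "real \<Rightarrow> mechanism \<Rightarrow> real list \<Rightarrow> real list \<Rightarrow> nat \<Rightarrow> real list \<Rightarrow> bool" where
  "pure_nash \<epsilon> A v B m s \<longleftrightarrow>
     is_profile \<epsilon> v s \<and> (\<forall>i<length v. \<not> can_improve \<epsilon> A v B m s i)"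

definition best_response_step ::
  "real \<Rightarrow> mechanism \<Rightarrow> real list \<Rightarrow> real list \<Rightarrow> nat \<Rightarrow> nat \<Rightarrow> real list \<Rightarrow> real list \<Rightarrow> bool" where
  "best_response_step \<epsilon> A v B m i s s' \<longleftrightarrow>
     i < length v \<and> can_improve \<epsilon> A v B m s i \<and>
     (\<exists>r\<in>grid \<epsilon>. s' = s[i := r] \<and>
        (\<forall>r'\<in>grid \<epsilon>. buyer_utility A v B m (s[i := r']) i \<le> buyer_utility A v B m s' i))"

text \<open>
  A run of \<open>T\<close> steps from \<open>s\<^sub>0\<close>: \<open>\<sigma> t\<close> is the profile after \<open>t\<close> steps, \<open>\<mu> t\<close> the buyer moving
  from \<open>\<sigma> t\<close> to \<open>\<sigma> (Suc t)\<close>. Values of \<open>\<sigma>\<close> beyond \<open>T\<close>, and of \<open>\<mu>\<close> from \<open>T\<close> on, are irrelevant.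
\<close>

definition best_response_run ::
  "real \<Rightarrow> mechanism \<Rightarrow> real list \<Rightarrow> real list \<Rightarrow> nat \<Rightarrow> real list \<Rightarrow>
   (nat \<Rightarrow> real list) \<Rightarrow> (nat \<Rightarrow> nat) \<Rightarrow> nat \<Rightarrow> bool" where
  "best_response_run \<epsilon> A v B m s\<^sub>0 \<sigma> \<mu> T \<longleftrightarrow>
     \<sigma> 0 = s\<^sub>0 \<and> (\<forall>t<T. best_response_step \<epsilon> A v B m (\<mu> t) (\<sigma> t) (\<sigma> (Suc t)))"

text \<open>
  Convergence, whatever the order of moves and the choice among best responses: no run continues
  forever, and no run gets stuck because a buyer who can improve lacks a utility-maximizing report
  (the report space is infinite). Hence every run can be continued to one after which no buyer can
  improve, and must reach such a profile after finitely many steps.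
\<close>

definition best_response_converges ::
  "real \<Rightarrow> mechanism \<Rightarrow> real list \<Rightarrow> real list \<Rightarrow> nat \<Rightarrow> real list \<Rightarrow> bool" where
  "best_response_converges \<epsilon> A v B m s\<^sub>0 \<longleftrightarrow>
     (\<nexists>\<sigma> \<mu>. \<forall>T. best_response_run \<epsilon> A v B m s\<^sub>0 \<sigma> \<mu> T) \<and>
     (\<forall>\<sigma> \<mu> T i. best_response_run \<epsilon> A v B m s\<^sub>0 \<sigma> \<mu> T \<and> i < length v \<and>
        can_improve \<epsilon> A v B m (\<sigma> T) i \<longrightarrow>
        (\<exists>s'. best_response_step \<epsilon> A v B m i (\<sigma> T) s'))"

end

theory Submission
  imports Defs
begin

text \<open>
  Convergence. If a buyer who currently holds its full demand at the price \<open>p\<close> improves its utility,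
  then the price must fall below \<open>p\<close>, since at a higher price it can afford no more units. The gain is
  positive, so the new price is also below the mover's valuation, and its new report is at least the
  new price. Hence, along the dynamic from the truthful profile, every buyer interested in buying
  still reports more than the current price and so obtains its full demand; the only exception is the
  last mover, who may report exactly the price, but cannot improve at once. So the price falls in
  every step, which can happen only finitely often on a grid.

  Cycle. Let all profiles but a few be priced so high that nobody buys. For prices and reports
  \<open>p\<^sub>1 < b < p\<^sub>2 < w < p\<^sub>3 < h\<close> and valuations \<open>(h, w)\<close>, the reports cycle through
  \<open>(h, h), (h, 0), (b, 0), (b, h)\<close>, with prices \<open>p\<^sub>3\<close>, prohibitive, \<open>p\<^sub>1\<close>, \<open>p\<^sub>2\<close>: buyer 1 is driven
  out by a price above its valuation, buyer 0 lowers the price, buyer 1 returns and raises it above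
  the report of buyer 0, who then returns to
  its true valuation \<open>h\<close>. The profile \<open>(h, h)\<close> is not truthful because buyer 1 overbids.
\<close>

section \<open>Grids and demand sets\<close>

lemma mem_grid_add_le:
  assumes "e > 0" "p \<in> grid e" "q \<in> grid e" "p < q"
  shows "p + e \<le> q"
proof -
  obtain k l :: nat where kl: "p = real k * e" "q = real l * e"
    using assms by (auto simp: grid_def)
  then have "Suc k \<le> l"
    using assms by (simp add: mult_less_cancel_right)
  then have "real (Suc k) * e \<le> real l * e"
    using assms(1) by (intro mult_right_mono) (auto simp del: of_nat_Suc)
  then show ?thesis
    by (simp add: kl algebra_simps)
qed

lemma mem_grid_nonneg: "e > 0 \<Longrightarrow> p \<in> grid e \<Longrightarrow> 0 \<le> p"
  by (auto simp: grid_def)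

lemma of_nat_mult_mem_grid [simp]: "real k * e \<in> grid e"
  by (auto simp: grid_def)

lemma finite_grid_lessThan:
  assumes "e > 0"
  shows "finite (grid e \<inter> {..<q})"
proof -
  have "grid e \<inter> {..<q} \<subseteq> (\<lambda>k. real k * e) ` {..nat \<lceil>q / e\<rceil>}"
  proof
    fix p assume "p \<in> grid e \<inter> {..<q}"
    then obtain k :: nat where k: "p = real k * e" "real k * e < q"
      by (auto simp: grid_def)
    then have "real k < q / e"
      using assms by (simp add: field_simps)
    then have "k \<le> nat \<lceil>q / e\<rceil>"
      by linarith
    with k show "p \<in> (\<lambda>k. real k * e) ` {..nat \<lceil>q / e\<rceil>}"
      by auto
  qed
  then show ?thesis
    by (rule finite_subset) simp
qed

lemma grid_unbounded:
  assumes "e > 0"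
  obtains p where "p \<in> grid e" "p > q"
proof -
  obtain k :: nat where "q / e < real k"
    using reals_Archimedean2 by blast
  then have "real k * e > q"
    using assms by (simp add: field_simps)
  then show thesis
    using that[OF of_nat_mult_mem_grid] by blast
qed

lemma demand_subset: "demand u b m p \<subseteq> {..min (nat \<lfloor>b / p\<rfloor>) m}"
  by (auto simp: demand_def)

text \<open>Keeps envy-free outcomes away from the \<infinity> branch of
  \<open>utility\<close>.\<close>

lemma demand_affordable:
  assumes "k \<in> demand u b m p" "p > 0" "b > 0"
  shows "p * real k \<le> b"
proof -
  have "k \<le> nat \<lfloor>b / p\<rfloor>"
    using assms(1) demand_subset by fastforce
  then have "real k \<le> b / p"
    using assms by (simp add: le_nat_floor le_nat_iff le_floor_iff)
  then show ?thesis
    using assms by (simp add: field_simps)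
qed

lemma full_demand_antimono:
  assumes "0 < p" "p \<le> q" "b > (0::real)"
  shows "min (nat \<lfloor>b / q\<rfloor>) m \<le> min (nat \<lfloor>b / p\<rfloor>) m"
proof -
  have "b / q \<le> b / p"
    using assms by (simp add: frac_le)
  then have "nat \<lfloor>b / q\<rfloor> \<le> nat \<lfloor>b / p\<rfloor>"
    by (intro nat_mono floor_mono)
  then show ?thesis
    by simp
qed

section \<open>Best responses from the truthful profile\<close>

locale market_mechanism =
  fixes \<epsilon> \<delta> :: real and A :: mechanism and v B :: "real list" and m :: nat
  assumes \<epsilon>_pos: "\<epsilon> > 0" and \<delta>_pos: "\<delta> > 0"
    and mechanism: "envy_free_mechanism \<epsilon> \<delta> A" and market: "is_market \<epsilon> v B"
begin

section \<open>Outcomes and gains at a profile of reports\<close>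

definition price :: "real list \<Rightarrow> real" where
  "price s = snd (A s B m)"

text \<open>Real-valued stand-in for \<open>buyer_utility\<close>: envy-free outcomes respect
  budgets, so utilities are finite and ordinary arithmetic applies.\<close>

definition gain :: "real list \<Rightarrow> nat \<Rightarrow> real" where
  "gain s i = (v ! i - price s) * real (units A B m s i)"

lemma budget_pos: "i < length v \<Longrightarrow> B ! i > 0"
  using market by (auto simp: is_market_def)

lemma profile_truthful: "is_profile \<epsilon> v v"
  using market by (auto simp: is_market_def is_profile_def)

lemma profile_update:
  "is_profile \<epsilon> v s \<Longrightarrow> r \<in> grid \<epsilon> \<Longrightarrow> is_profile \<epsilon> v (s[i := r])"
  using set_update_subset_insert[of s i r] by (auto simp: is_profile_def)

lemma outcome_profile:
  assumes "is_profile \<epsilon> v s"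
  shows "envy_free_pricing s B m (A s B m)" "price s \<in> grid \<delta>"
proof -
  have "is_market \<epsilon> s B"
    using assms market by (auto simp: is_market_def is_profile_def)
  then show "envy_free_pricing s B m (A s B m)" "price s \<in> grid \<delta>"
    using mechanism by (auto simp: envy_free_mechanism_def price_def)
qed

lemma price_pos: "is_profile \<epsilon> v s \<Longrightarrow> price s > 0"
  using outcome_profile(1)[of s] by (auto simp: envy_free_pricing_def price_def)

lemma units_mem_demand:
  assumes "is_profile \<epsilon> v s" "i < length v"
  shows "units A B m s i \<in> demand (s ! i) (B ! i) m (price s)"
  using outcome_profile(1)[of s] assms
  by (auto simp: envy_free_pricing_def price_def units_def is_profile_def)

lemma units_le_full:
  assumes "is_profile \<epsilon> v s" "i < length v"
  shows "units A B m s i \<le> min (nat \<lfloor>B ! i / price s\<rfloor>) m"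
  using units_mem_demand[OF assms] demand_subset by blast

lemma units_eq_full:
  assumes "is_profile \<epsilon> v s" "i < length v" "price s < s ! i"
  shows "units A B m s i = min (nat \<lfloor>B ! i / price s\<rfloor>) m"
  using units_mem_demand[OF assms(1,2)] assms(3) by (simp add: demand_def)

lemma units_eq_0:
  assumes "is_profile \<epsilon> v s" "i < length v" "s ! i < price s"
  shows "units A B m s i = 0"
  using units_mem_demand[OF assms(1,2)] assms(3) by (simp add: demand_def)

lemma buyer_utility_eq_gain:
  assumes "is_profile \<epsilon> v s" "i < length v"
  shows "buyer_utility A v B m s i = ereal (gain s i)"
  using demand_affordable[OF units_mem_demand[OF assms] price_pos[OF assms(1)] budget_pos[OF assms(2)]]
  by (simp add: buyer_utility_def utility_def gain_def price_def algebra_simps)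

lemma can_improve_iff:
  assumes "is_profile \<epsilon> v s" "i < length v"
  shows "can_improve \<epsilon> A v B m s i \<longleftrightarrow> (\<exists>r\<in>grid \<epsilon>. gain s i < gain (s[i := r]) i)"
  using assms by (simp add: can_improve_def buyer_utility_eq_gain profile_update)

text \<open>A loss would need a price above the valuation. In that case the report is the valuation
  itself, hence below the price, and nothing is bought.\<close>

lemma gain_nonneg:
  assumes "is_profile \<epsilon> v s" "i < length v" "s ! i = v ! i \<or> price s < v ! i"
  shows "0 \<le> gain s i"
  using assms units_eq_0[OF assms(1,2)]
  by (cases "price s \<le> v ! i") (auto simp: gain_def)

text \<open>A positive gain needs a positive margin and a unit sold, and no unit goes to a report
  below the price.\<close>

lemma gain_pos_imp:
  assumes "is_profile \<epsilon> v s" "i < length v" "gain s i > 0"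
  shows "price s < v ! i" "price s \<le> s ! i"
proof -
  show "price s < v ! i"
    using assms(3) by (auto simp: gain_def zero_less_mult_iff)
  show "price s \<le> s ! i"
    using assms units_eq_0[OF assms(1,2)] by (force simp: gain_def)
qed

text \<open>The report space is infinite, but a positive gain is determined by a grid price below
  the valuation and a number of units up to \<open>m\<close>, so only finitely many positive gains
  occur. If there is none, the true valuation, whose gain is not negative, is a best
  response.\<close>

lemma best_response_exists:
  assumes s: "is_profile \<epsilon> v s" and i: "i < length v"
  obtains r where "r \<in> grid \<epsilon>" "\<And>r'. r' \<in> grid \<epsilon> \<Longrightarrow> gain (s[i := r']) i \<le> gain (s[i := r]) i"
proof -
  let ?g = "\<lambda>r. gain (s[i := r]) i"
  let ?P = "grid \<epsilon> \<inter> {r. 0 < ?g r}"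
  have vi: "v ! i \<in> grid \<epsilon>"
    using market i by (auto simp: is_market_def)
  have "?g (v ! i) \<ge> 0"
    using s i by (intro gain_nonneg profile_update vi) (auto simp: is_profile_def)
  have "?g ` ?P \<subseteq> (\<lambda>(p, k). (v ! i - p) * real k) ` ((grid \<delta> \<inter> {..<v ! i}) \<times> {..m})"
  proof
    fix y assume "y \<in> ?g ` ?P"
    then obtain r where r: "r \<in> grid \<epsilon>" "0 < ?g r" "y = ?g r"
      by auto
    note prof = profile_update[OF s r(1), of i]
    have "price (s[i := r]) \<in> grid \<delta> \<inter> {..<v ! i}"
      using outcome_profile(2)[OF prof] gain_pos_imp(1)[OF prof i r(2)] by simp
    moreover have "units A B m (s[i := r]) i \<in> {..m}"
      using units_le_full[OF prof i] by simp
    ultimately show "y \<in> (\<lambda>(p, k). (v ! i - p) * real k) ` ((grid \<delta> \<inter> {..<v ! i}) \<times> {..m})"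
      unfolding r(3) gain_def by force
  qed
  then have fin: "finite (?g ` ?P)"
    by (rule finite_subset) (simp add: finite_grid_lessThan \<delta>_pos)
  show thesis
  proof (cases "?P = {}")
    case True
    then have "?g r' \<le> ?g (v ! i)" if "r' \<in> grid \<epsilon>" for r'
      using that \<open>?g (v ! i) \<ge> 0\<close> by force
    then show thesis
      using that vi by blast
  next
    case False
    then have "Max (?g ` ?P) \<in> ?g ` ?P"
      using fin by (intro Max_in) auto
    then obtain r where r: "r \<in> ?P" "Max (?g ` ?P) = ?g r"
      by auto
    have "?g r' \<le> ?g r" if "r' \<in> grid \<epsilon>" for r'
    proof (cases "r' \<in> ?P")
      case True
      then show ?thesis
        using Max_ge[OF fin] r(2) by fastforce
    next
      case False
      then show ?thesis
        using that r(1) by force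
    qed
    then show thesis
      using that r(1) by blast
  qed
qed

lemma best_response_step_exists:
  assumes "is_profile \<epsilon> v s" "i < length v" "can_improve \<epsilon> A v B m s i"
  shows "\<exists>s'. best_response_step \<epsilon> A v B m i s s'"
proof -
  obtain r where r: "r \<in> grid \<epsilon>" "\<And>r'. r' \<in> grid \<epsilon> \<Longrightarrow> gain (s[i := r']) i \<le> gain (s[i := r]) i"
    using best_response_exists[OF assms(1,2)] by blast
  then have "best_response_step \<epsilon> A v B m i s (s[i := r])"
    using assms by (auto simp: best_response_step_def buyer_utility_eq_gain profile_update)
  then show ?thesis ..
qed

text \<open>The mover cannot improve again at once: a second change overwrites the first, so it is
  among the alternatives already compared.\<close>

lemma best_response_stepE:
  assumes "best_response_step \<epsilon> A v B m i s s'" "is_profile \<epsilon> v s"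
  obtains r where "i < length v" "r \<in> grid \<epsilon>" "s' = s[i := r]" "gain s i < gain s' i"
    "\<not> can_improve \<epsilon> A v B m s' i"
proof -
  from assms(1) obtain r where r: "i < length v" "can_improve \<epsilon> A v B m s i" "r \<in> grid \<epsilon>" "s' = s[i := r]"
    "\<forall>r'\<in>grid \<epsilon>. buyer_utility A v B m (s[i := r']) i \<le> buyer_utility A v B m s' i"
    by (auto simp: best_response_step_def)
  note prof = profile_update[OF assms(2)]
  have max: "gain (s[i := r']) i \<le> gain s' i" if "r' \<in> grid \<epsilon>" for r'
    using r that by (simp add: buyer_utility_eq_gain prof)
  obtain r' where "r' \<in> grid \<epsilon>" "gain s i < gain (s[i := r']) i"
    using r(2) by (auto simp: can_improve_iff[OF assms(2) r(1)])
  then have "gain s i < gain s' i"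
    using max by fastforce
  moreover have "\<not> can_improve \<epsilon> A v B m s' i"
  proof -
    have "is_profile \<epsilon> v s'"
      using r prof by simp
    then show ?thesis
      using max r(1) by (auto simp: can_improve_iff not_less r(4))
  qed
  ultimately show thesis
    using that r by blast
qed

text \<open>The buyer \<open>d\<close> is meant to be the last mover, or any \<open>d \<ge> length v\<close> if nobody has moved.\<close>

definition nearly_truthful :: "nat \<Rightarrow> real list \<Rightarrow> bool" where
  "nearly_truthful d s \<longleftrightarrow>
     (\<forall>i<length v. s ! i = v ! i \<or>
        price s < v ! i \<and> price s \<le> s ! i \<and> (i = d \<or> price s < s ! i))"

text \<open>Buyer \<open>i\<close>, not being the exception \<open>d\<close>, reports strictly above
  the price, whether truthfully or not. A report equal to the price would allow partial
  demand.\<close>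

lemma nearly_truthful_full:
  assumes "is_profile \<epsilon> v s" "nearly_truthful d s" "i < length v" "i \<noteq> d" "price s < v ! i"
  shows "units A B m s i = min (nat \<lfloor>B ! i / price s\<rfloor>) m"
  using assms units_eq_full[of s i] by (auto simp: nearly_truthful_def)

lemma nearly_truthful_gain_nonneg:
  assumes "is_profile \<epsilon> v s" "nearly_truthful d s" "i < length v"
  shows "0 \<le> gain s i"
  using assms by (intro gain_nonneg) (auto simp: nearly_truthful_def)

text \<open>At a price no lower than \<open>price s\<close>, buyer \<open>i\<close> gets at most the
  full demand it holds at \<open>s\<close>, with no larger margin. Only the two prices and the units
  of \<open>i\<close> are compared, so \<open>s'\<close> may be any profile.\<close>

lemma improvement_lowers_price:
  assumes s: "is_profile \<epsilon> v s" "nearly_truthful d s" and i: "i < length v" "i \<noteq> d"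
    and s': "is_profile \<epsilon> v s'" and less: "gain s i < gain s' i"
  shows "price s' < price s" "price s' < v ! i" "price s' \<le> s' ! i"
proof -
  have "0 < gain s' i"
    using nearly_truthful_gain_nonneg[OF s i(1)] less by simp
  note pos = gain_pos_imp[OF s' i(1) this]
  then show "price s' < v ! i" "price s' \<le> s' ! i" .
  show "price s' < price s"
  proof (rule ccontr)
    assume "\<not> price s' < price s"
    then have le: "price s \<le> price s'"
      by simp
    have "units A B m s' i \<le> min (nat \<lfloor>B ! i / price s'\<rfloor>) m"
      by (rule units_le_full[OF s' i(1)])
    also have "\<dots> \<le> min (nat \<lfloor>B ! i / price s\<rfloor>) m"
      using full_demand_antimono[OF price_pos[OF s(1)] le budget_pos[OF i(1)]] .
    also have "\<dots> = units A B m s i"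
      using nearly_truthful_full[OF s i] pos(1) le by simp
    finally have "gain s' i \<le> gain s i"
      unfolding gain_def using le pos(1) by (intro mult_mono) auto
    with less show False
      by simp
  qed
qed

text \<open>The exception passes from \<open>d\<close> to \<open>i\<close>. As the price falls
  strictly, the weak bound on a non-truthful report of \<open>d\<close> becomes strict, while the
  new report of \<open>i\<close> may equal the new price.\<close>

lemma nearly_truthful_update:
  assumes s: "is_profile \<epsilon> v s" "nearly_truthful d s" and i: "i < length v" "i \<noteq> d"
    and r: "r \<in> grid \<epsilon>" and less: "gain s i < gain (s[i := r]) i"
  shows "nearly_truthful i (s[i := r])"
proof -
  have len: "length s = length v"
    using s(1) by (simp add: is_profile_def)
  note price = improvement_lowers_price[OF s i profile_update[OF s(1) r] less]
  show ?thesis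
    unfolding nearly_truthful_def
  proof (intro allI impI)
    fix j assume j: "j < length v"
    show "s[i := r] ! j = v ! j \<or> price (s[i := r]) < v ! j \<and> price (s[i := r]) \<le> s[i := r] ! j \<and>
      (j = i \<or> price (s[i := r]) < s[i := r] ! j)"
    proof (cases "j = i")
      case True
      then show ?thesis
        using price by simp
    next
      case False
      then show ?thesis
        using s(2) j price(1) by (fastforce simp: nearly_truthful_def)
    qed
  qed
qed

text \<open>If the lower price is below the valuation, \<open>i\<close> holds its full demand there,
  which is at least what it could get at \<open>price v\<close>. Otherwise \<open>price v\<close>
  exceeds the valuation and \<open>i\<close> buys nothing under truth-telling.\<close>

lemma nearly_truthful_improves_truthful:
  assumes s: "is_profile \<epsilon> v s" "nearly_truthful d s" and i: "i < length v" "i \<noteq> d"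
    and less: "price s < price v"
  shows "units A B m v i \<le> units A B m s i" "gain v i \<le> gain s i"
proof -
  have *: "units A B m v i \<le> units A B m s i \<and> gain v i \<le> gain s i"
  proof (cases "price s < v ! i")
    case True
    have "units A B m v i \<le> min (nat \<lfloor>B ! i / price v\<rfloor>) m"
      by (rule units_le_full[OF profile_truthful i(1)])
    also have "\<dots> \<le> min (nat \<lfloor>B ! i / price s\<rfloor>) m"
      using less by (intro full_demand_antimono price_pos s budget_pos i) simp
    also have "\<dots> = units A B m s i"
      using nearly_truthful_full[OF s i True] by simp
    finally show ?thesis
      using True less by (auto simp: gain_def intro!: mult_mono)
  next
    case False
    then have "units A B m v i = 0"
      using less by (intro units_eq_0 profile_truthful i) simp
    then show ?thesis
      using nearly_truthful_gain_nonneg[OF s i(1)] by (simp add: gain_def)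
  qed
  then show "units A B m v i \<le> units A B m s i" "gain v i \<le> gain s i"
    by auto
qed

section \<open>Runs from the truthful profile\<close>

text \<open>The default \<open>length v\<close> is no buyer's index, so nobody is exempt before the
  first move.\<close>

definition last_mover :: "(nat \<Rightarrow> nat) \<Rightarrow> nat \<Rightarrow> nat" where
  "last_mover \<mu> T = (if T = 0 then length v else \<mu> (T - 1))"

lemma run_invariant:
  assumes "best_response_run \<epsilon> A v B m v \<sigma> \<mu> T"
  shows "is_profile \<epsilon> v (\<sigma> T) \<and> nearly_truthful (last_mover \<mu> T) (\<sigma> T) \<and>
    (last_mover \<mu> T < length v \<longrightarrow> \<not> can_improve \<epsilon> A v B m (\<sigma> T) (last_mover \<mu> T)) \<and>
    price (\<sigma> T) + real T * \<delta> \<le> price v \<and> (\<forall>i<length v. gain v i \<le> gain (\<sigma> T) i)"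
  using assms
proof (induction T)
  case 0
  then have "\<sigma> 0 = v"
    by (simp add: best_response_run_def)
  then show ?case
    by (simp add: profile_truthful nearly_truthful_def last_mover_def)
next
  case (Suc T)
  let ?d = "last_mover \<mu> T" and ?i = "\<mu> T"
  from Suc.prems have "best_response_run \<epsilon> A v B m v \<sigma> \<mu> T"
    and step: "best_response_step \<epsilon> A v B m ?i (\<sigma> T) (\<sigma> (Suc T))"
    by (auto simp: best_response_run_def)
  then have s: "is_profile \<epsilon> v (\<sigma> T)" "nearly_truthful ?d (\<sigma> T)"
    and d: "?d < length v \<longrightarrow> \<not> can_improve \<epsilon> A v B m (\<sigma> T) ?d"
    and price: "price (\<sigma> T) + real T * \<delta> \<le> price v"
    and gain: "\<forall>i<length v. gain v i \<le> gain (\<sigma> T) i"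
    using Suc.IH by auto
  obtain r where r: "?i < length v" "r \<in> grid \<epsilon>" "\<sigma> (Suc T) = (\<sigma> T)[?i := r]"
    "gain (\<sigma> T) ?i < gain (\<sigma> (Suc T)) ?i" "\<not> can_improve \<epsilon> A v B m (\<sigma> (Suc T)) ?i"
    using step s(1) by (rule best_response_stepE)
  \<comment> \<open>The exceptional buyer has just played a best response, so someone else moves.
    This is why the invariant records that it cannot improve.\<close>
  have "?i \<noteq> ?d"
    using d r(1) step by (auto simp: best_response_step_def)
  have s': "is_profile \<epsilon> v (\<sigma> (Suc T))"
    using profile_update[OF s(1) r(2)] r(3) by simp
  have nt': "nearly_truthful ?i (\<sigma> (Suc T))"
    using nearly_truthful_update[OF s r(1) \<open>?i \<noteq> ?d\<close> r(2)] r(3,4) by simp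
  have "price (\<sigma> (Suc T)) < price (\<sigma> T)"
    using improvement_lowers_price(1)[OF s r(1) \<open>?i \<noteq> ?d\<close> s' r(4)] .
  then have "price (\<sigma> (Suc T)) + \<delta> \<le> price (\<sigma> T)"
    using mem_grid_add_le \<delta>_pos outcome_profile(2) s(1) s' by blast
  then have price': "price (\<sigma> (Suc T)) + real (Suc T) * \<delta> \<le> price v"
    using price by (simp add: algebra_simps)
  moreover have "real (Suc T) * \<delta> > 0"
    using \<delta>_pos by simp
  ultimately have "price (\<sigma> (Suc T)) < price v"
    by linarith
  \<comment> \<open>The mover, who may lack its full demand, inherits the bound from its smaller
    gain before the move. All others are compared with truth-telling directly.\<close>
  then have "gain v i \<le> gain (\<sigma> (Suc T)) i" if "i < length v" for i
    using nearly_truthful_improves_truthful(2)[OF s' nt' that] that gain r(1,4)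
    by (cases "i = ?i") force+
  then show ?case
    using s' nt' r(5) price' by (simp add: last_mover_def)
qed

lemma best_response_converges_truthful: "best_response_converges \<epsilon> A v B m v"
  unfolding best_response_converges_def
proof (intro conjI notI allI impI)
  assume "\<exists>\<sigma> \<mu>. \<forall>T. best_response_run \<epsilon> A v B m v \<sigma> \<mu> T"
  then obtain \<sigma> \<mu> where run: "best_response_run \<epsilon> A v B m v \<sigma> \<mu> T" for T
    by blast
  \<comment> \<open>So many steps, each lowering the price by at least \<open>\<delta>\<close>,
    would use up the initial price, yet prices stay positive.\<close>
  obtain T :: nat where "price v / \<delta> < real T"
    using reals_Archimedean2 by blast
  then have "price v < real T * \<delta>"
    using \<delta>_pos by (simp add: field_simps)
  moreover have "price (\<sigma> T) + real T * \<delta> \<le> price v" "price (\<sigma> T) > 0"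
    using run_invariant[OF run] price_pos by auto
  ultimately show False
    by simp
next
  fix \<sigma> \<mu> T i
  assume "best_response_run \<epsilon> A v B m v \<sigma> \<mu> T \<and> i < length v \<and> can_improve \<epsilon> A v B m (\<sigma> T) i"
  then show "\<exists>s'. best_response_step \<epsilon> A v B m i (\<sigma> T) s'"
    using run_invariant best_response_step_exists by blast
qed

text \<open>Whenever a buyer can improve, it has a best response; hence the absence of best response
  steps already gives an equilibrium.\<close>

lemma terminal_profile:
  assumes run: "best_response_run \<epsilon> A v B m v \<sigma> \<mu> T"
    and terminal: "\<nexists>i s'. best_response_step \<epsilon> A v B m i (\<sigma> T) s'"
  shows "pure_nash \<epsilon> A v B m (\<sigma> T)"
    and "i < length v \<Longrightarrow> buyer_utility A v B m v i \<le> buyer_utility A v B m (\<sigma> T) i"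
    and "i < length v \<Longrightarrow> \<not> (T > 0 \<and> i = \<mu> (T - 1)) \<Longrightarrow> units A B m v i \<le> units A B m (\<sigma> T) i"
proof -
  note inv = run_invariant[OF run]
  then have s: "is_profile \<epsilon> v (\<sigma> T)" "nearly_truthful (last_mover \<mu> T) (\<sigma> T)"
    by auto
  show "pure_nash \<epsilon> A v B m (\<sigma> T)"
    unfolding pure_nash_def using s(1) terminal best_response_step_exists by blast
  show "buyer_utility A v B m v i \<le> buyer_utility A v B m (\<sigma> T) i" if "i < length v"
    using inv that by (simp add: buyer_utility_eq_gain s(1) profile_truthful)
  show "units A B m v i \<le> units A B m (\<sigma> T) i"
    if i: "i < length v" "\<not> (T > 0 \<and> i = \<mu> (T - 1))"
  \<comment> \<open>Without moves the outcome is the truthful one; after a move the price is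
    strictly lower.\<close>
  proof (cases "T = 0")
    case True
    then show ?thesis
      using run by (simp add: best_response_run_def)
  next
    case False
    then have "real T * \<delta> > 0"
      using \<delta>_pos by simp
    then have "price (\<sigma> T) < price v"
      using inv by linarith
    then show ?thesis
      using s i False by (intro nearly_truthful_improves_truthful) (auto simp: last_mover_def)
  qed
qed

end

section \<open>A cycle from a non-truthful profile\<close>

text \<open>The sum of the nonnegative reports bounds each of them. The \<open>+ 1\<close> puts the
  price strictly above it, and makes it positive even when all reports are zero.\<close>

definition prohibitive_outcome :: "real \<Rightarrow> real list \<Rightarrow> outcome" where
  "prohibitive_outcome \<delta> s =
     (replicate (length s) 0, real (nat \<lceil>sum_list s / \<delta>\<rceil> + 1) * \<delta>)"

lemma prohibitive_outcome:
  assumes "\<epsilon> > 0" "\<delta> > 0" "is_market \<epsilon> s B"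
  shows "envy_free_pricing s B m (prohibitive_outcome \<delta> s)"
    and "snd (prohibitive_outcome \<delta> s) \<in> grid \<delta>"
proof -
  let ?p = "snd (prohibitive_outcome \<delta> s)"
  have nonneg: "0 \<le> x" if "x \<in> set s" for x
    using assms that mem_grid_nonneg by (auto simp: is_market_def)
  have "sum_list s / \<delta> < real (nat \<lceil>sum_list s / \<delta>\<rceil> + 1)"
    by linarith
  then have "sum_list s < ?p"
    using assms(2) by (simp add: prohibitive_outcome_def field_simps)
  moreover have "s ! i \<le> sum_list s" if "i < length s" for i
    using that nonneg by (intro member_le_sum_list) auto
  ultimately have "s ! i < ?p" if "i < length s" for i
    using that by fastforce
  then show "envy_free_pricing s B m (prohibitive_outcome \<delta> s)"
    using assms(2)
    by (fastforce simp: envy_free_pricing_def prohibitive_outcome_def demand_def sum_list_replicate)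
  show "?p \<in> grid \<delta>"
    unfolding prohibitive_outcome_def snd_conv by (rule of_nat_mult_mem_grid)
qed

text \<open>Envy-freeness is required on every market, so the special outcomes are confined to one
  choice of budgets and supply. The profile \<open>[h, 0]\<close> of the cycle falls under the
  prohibitive case.\<close>

definition cyclic_mechanism ::
  "real \<Rightarrow> real \<Rightarrow> real \<Rightarrow> real \<Rightarrow> real \<Rightarrow> real \<Rightarrow> nat \<Rightarrow> mechanism" where
  "cyclic_mechanism \<delta> h b p\<^sub>1 p\<^sub>2 p\<^sub>3 k s B m =
     (if B = [h, h] \<and> m = 2 * k then
        if s = [h, h] then ([k, k], p\<^sub>3)
        else if s = [b, 0] then ([min (nat \<lfloor>h / p\<^sub>1\<rfloor>) m, 0], p\<^sub>1)
        else if s = [b, h] then ([0, min (nat \<lfloor>h / p\<^sub>2\<rfloor>) m], p\<^sub>2)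
        else prohibitive_outcome \<delta> s
      else prohibitive_outcome \<delta> s)"

lemma best_response_cycle:
  assumes e: "\<epsilon> > 0" "\<delta> > 0"
  shows "\<exists>A v B m s\<^sub>0 \<sigma> \<mu> T.
    envy_free_mechanism \<epsilon> \<delta> A \<and> is_market \<epsilon> v B \<and>
    is_profile \<epsilon> v s\<^sub>0 \<and> s\<^sub>0 \<noteq> v \<and>
    T > 0 \<and> best_response_run \<epsilon> A v B m s\<^sub>0 \<sigma> \<mu> T \<and> \<sigma> T = s\<^sub>0"
proof -
  \<comment> \<open>The chain alternates between the price grid and the report grid, which works for
    any grid widths because both grids are unbounded.\<close>
  obtain p\<^sub>1 where p1: "p\<^sub>1 \<in> grid \<delta>" "0 < p\<^sub>1" using grid_unbounded e(2) .
  obtain b where b: "b \<in> grid \<epsilon>" "p\<^sub>1 < b" using grid_unbounded e(1) .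
  obtain p\<^sub>2 where p2: "p\<^sub>2 \<in> grid \<delta>" "b < p\<^sub>2" using grid_unbounded e(2) .
  obtain w where w: "w \<in> grid \<epsilon>" "p\<^sub>2 < w" using grid_unbounded e(1) .
  obtain p\<^sub>3 where p3: "p\<^sub>3 \<in> grid \<delta>" "w < p\<^sub>3" using grid_unbounded e(2) .
  obtain h where h: "h \<in> grid \<epsilon>" "p\<^sub>3 < h" using grid_unbounded e(1) .
  note order = p1(2) b(2) p2(2) w(2) p3(2) h(2)
  \<comment> \<open>The full demand at \<open>p\<^sub>3\<close> under budget \<open>h\<close>;
    supply \<open>2 * k\<close> then serves both buyers at \<open>[h, h]\<close>.\<close>
  define k where "k = nat \<lfloor>h / p\<^sub>3\<rfloor>"
  define m where "m = 2 * k"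
  define A where "A = cyclic_mechanism \<delta> h b p\<^sub>1 p\<^sub>2 p\<^sub>3 k"
  let ?v = "[h, w]" and ?B = "[h, h]"
  have floor_ge_1: "nat \<lfloor>h / p\<rfloor> \<ge> 1" if "0 < p" "p < h" for p
    using that by (simp add: le_nat_iff le_floor_iff)
  have k: "k \<ge> 1"
    unfolding k_def using order by (intro floor_ge_1) auto
  have zero: "(0::real) \<in> grid \<epsilon>"
    using of_nat_mult_mem_grid[of 0 \<epsilon>] by simp
  define n1 where "n1 = min (nat \<lfloor>h / p\<^sub>1\<rfloor>) m"
  define n2 where "n2 = min (nat \<lfloor>h / p\<^sub>2\<rfloor>) m"
  have n: "n1 \<ge> 1" "n2 \<ge> 1"
    using floor_ge_1[of p\<^sub>1] floor_ge_1[of p\<^sub>2] order k by (auto simp: n1_def n2_def m_def)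
  have afford: "p * real l \<le> h" if "l \<le> nat \<lfloor>h / p\<rfloor>" "0 < p" for p l
    using that order demand_affordable[of l p h l p] by (auto simp: demand_def)
  have A_eq: "A s ?B m = (if s = [h, h] then ([k, k], p\<^sub>3) else if s = [b, 0] then ([n1, 0], p\<^sub>1)
      else if s = [b, h] then ([0, n2], p\<^sub>2) else prohibitive_outcome \<delta> s)" for s
    by (simp add: A_def cyclic_mechanism_def n1_def n2_def m_def)
  have "envy_free_mechanism \<epsilon> \<delta> A"
    unfolding envy_free_mechanism_def
  proof (intro allI impI)
    fix s B and m' :: nat
    assume mk: "is_market \<epsilon> s B"
    \<comment> \<open>No report equals the price: those above it get full demand, those below it
      nothing.\<close>
    have "envy_free_pricing [h, h] ?B m ([k, k], p\<^sub>3)" "envy_free_pricing [b, 0] ?B m ([n1, 0], p\<^sub>1)"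
      "envy_free_pricing [b, h] ?B m ([0, n2], p\<^sub>2)"
      using order k unfolding n1_def n2_def
      by (auto simp: envy_free_pricing_def demand_def m_def k_def nth_Cons' less_Suc_eq)
    moreover have "A s B m' = prohibitive_outcome \<delta> s" if "\<not> (B = ?B \<and> m' = m)"
      using that by (auto simp: A_def cyclic_mechanism_def m_def)
    ultimately show "envy_free_pricing s B m' (A s B m') \<and> snd (A s B m') \<in> grid \<delta>"
      using prohibitive_outcome[OF e mk] p1 p2 p3
      by (cases "B = ?B \<and> m' = m") (auto simp: A_eq)
  qed
  moreover have "is_market \<epsilon> ?v ?B"
    using order h w by (auto simp: is_market_def)
  moreover have "is_profile \<epsilon> ?v [h, h]" "[h, h] \<noteq> ?v"
    using order h by (auto simp: is_profile_def)
  moreover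
  let ?U = "buyer_utility A ?v ?B m"
  have U: "?U [h, h] 0 = ereal ((h - p\<^sub>3) * real k)" "?U [h, h] 1 = ereal ((w - p\<^sub>3) * real k)"
    "?U [b, 0] 0 = ereal ((h - p\<^sub>1) * real n1)" "?U [b, 0] 1 = 0"
    "?U [b, h] 0 = 0" "?U [b, h] 1 = ereal ((w - p\<^sub>2) * real n2)"
    using afford[of k p\<^sub>3] afford[of n1 p\<^sub>1] afford[of n2 p\<^sub>2] order
    by (auto simp: buyer_utility_def utility_def units_def A_eq k_def n1_def n2_def algebra_simps
        zero_ereal_def)
  have U_other: "?U [x, y] i = 0"
    if "[x, y] \<notin> {[h, h], [b, 0], [b, h]}" "i < 2" for x y i
    using that order
    by (auto simp: buyer_utility_def utility_def units_def A_eq prohibitive_outcome_def nth_Cons'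
        zero_ereal_def)
  have pos: "0 < (h - p\<^sub>3) * real k" "(w - p\<^sub>3) * real k < 0" "0 < (h - p\<^sub>1) * real n1"
    "0 < (w - p\<^sub>2) * real n2"
    using order k n by (auto simp: mult_less_0_iff)
  have step: "best_response_step \<epsilon> A ?v ?B m i s (s[i := r])"
    if "i < 2" "r \<in> grid \<epsilon>" "?U s i < ?U (s[i := r]) i"
      "\<And>r'. ?U (s[i := r']) i \<le> ?U (s[i := r]) i" for i s r
    using that by (auto simp: best_response_step_def can_improve_def)
  define \<sigma> where "\<sigma> = (!) [[h, h], [h, 0], [b, 0], [b, h], [h, h]]"
  define \<mu> :: "nat \<Rightarrow> nat" where "\<mu> = (!) [1, 0, 1, 0]"
  have U_case: "?U [h, 0] 0 = 0" "?U [h, 0] 1 = 0"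
    using order by (auto intro: U_other)
  \<comment> \<open>Buyer 1 pays more than \<open>w\<close> per unit at \<open>[h, h]\<close>. Any
    other report leads to a prohibitive price and utility 0, so 0 is one of many best
    responses.\<close>
  have "best_response_step \<epsilon> A ?v ?B m 1 [h, h] [h, 0]"
  proof -
    have "?U [h, r'] 1 \<le> 0" for r'
      using order pos U U_other[of h r' 1] by (cases "r' = h") auto
    then show ?thesis
      using step[of 1 0 "[h, h]"] zero U U_case pos by simp
  qed
  \<comment> \<open>Against report 0 of buyer 1, only \<open>b\<close> leads to a sale.\<close>
  moreover have "best_response_step \<epsilon> A ?v ?B m 0 [h, 0] [b, 0]"
  proof -
    have "?U [r', 0] 0 \<le> ?U [b, 0] 0" for r'
      using order pos U U_other[of r' 0 0] by (cases "r' = b") auto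
    then show ?thesis
      using step[of 0 b "[h, 0]"] b U U_case pos by simp
  qed
  moreover have "best_response_step \<epsilon> A ?v ?B m 1 [b, 0] [b, h]"
  proof -
    have "?U [b, r'] 1 \<le> ?U [b, h] 1" for r'
      using order pos U U_other[of b r' 1] by (cases "r' = h"; cases "r' = 0") auto
    then show ?thesis
      using step[of 1 h "[b, 0]"] h U pos by simp
  qed
  \<comment> \<open>Against \<open>h\<close>, buyer 0 buys only by reporting \<open>h\<close>: the
    report \<open>b\<close> is below \<open>p\<^sub>2\<close>, and all others meet prohibitive
    prices.\<close>
  moreover have "best_response_step \<epsilon> A ?v ?B m 0 [b, h] [h, h]"
  proof -
    have "?U [r', h] 0 \<le> ?U [h, h] 0" for r'
      using order pos U U_other[of r' h 0] by (cases "r' = h"; cases "r' = b") auto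
    then show ?thesis
      using step[of 0 h "[b, h]"] h U pos by simp
  qed
  ultimately have "best_response_run \<epsilon> A ?v ?B m [h, h] \<sigma> \<mu> 4"
    by (auto simp: best_response_run_def \<sigma>_def \<mu>_def numeral_eq_Suc less_Suc_eq)
  moreover have "\<sigma> 4 = [h, h]"
    by (simp add: \<sigma>_def)
  ultimately show ?thesis
    using \<open>envy_free_mechanism \<epsilon> \<delta> A\<close> \<open>is_market \<epsilon> ?v ?B\<close> \<open>is_profile \<epsilon> ?v [h, h]\<close> \<open>[h, h] \<noteq> ?v\<close>
    by (metis zero_less_numeral)
qed

theorem theorem1p1:
  fixes \<epsilon> \<delta> :: real
  assumes "\<epsilon> > 0" and "\<delta> > 0"
  shows
    "(\<forall>A v B m. envy_free_mechanism \<epsilon> \<delta> A \<and> is_market \<epsilon> v B \<longrightarrow>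
        best_response_converges \<epsilon> A v B m v \<and>
        (\<forall>\<sigma> \<mu> T. best_response_run \<epsilon> A v B m v \<sigma> \<mu> T \<and>
           (\<nexists>i s'. best_response_step \<epsilon> A v B m i (\<sigma> T) s') \<longrightarrow>
           pure_nash \<epsilon> A v B m (\<sigma> T) \<and>
           (\<forall>i<length v. buyer_utility A v B m v i \<le> buyer_utility A v B m (\<sigma> T) i) \<and>
           (\<forall>i<length v. \<not> (T > 0 \<and> i = \<mu> (T - 1)) \<longrightarrow>
              units A B m v i \<le> units A B m (\<sigma> T) i))) \<and>
     (\<exists>A v B m s\<^sub>0 \<sigma> \<mu> T.
        envy_free_mechanism \<epsilon> \<delta> A \<and> is_market \<epsilon> v B \<and>
        is_profile \<epsilon> v s\<^sub>0 \<and> s\<^sub>0 \<noteq> v \<and>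
        T > 0 \<and> best_response_run \<epsilon> A v B m s\<^sub>0 \<sigma> \<mu> T \<and> \<sigma> T = s\<^sub>0)"
proof (rule conjI)
  show "\<forall>A v B m. envy_free_mechanism \<epsilon> \<delta> A \<and> is_market \<epsilon> v B \<longrightarrow>
      best_response_converges \<epsilon> A v B m v \<and>
      (\<forall>\<sigma> \<mu> T. best_response_run \<epsilon> A v B m v \<sigma> \<mu> T \<and>
         (\<nexists>i s'. best_response_step \<epsilon> A v B m i (\<sigma> T) s') \<longrightarrow>
         pure_nash \<epsilon> A v B m (\<sigma> T) \<and>
         (\<forall>i<length v. buyer_utility A v B m v i \<le> buyer_utility A v B m (\<sigma> T) i) \<and>
         (\<forall>i<length v. \<not> (T > 0 \<and> i = \<mu> (T - 1)) \<longrightarrow>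
            units A B m v i \<le> units A B m (\<sigma> T) i))"
  proof (intro allI impI, elim conjE)
    fix A v B m
    assume "envy_free_mechanism \<epsilon> \<delta> A" "is_market \<epsilon> v B"
    then interpret market_mechanism \<epsilon> \<delta> A v B m
      using assms by unfold_locales
    show "best_response_converges \<epsilon> A v B m v \<and>
      (\<forall>\<sigma> \<mu> T. best_response_run \<epsilon> A v B m v \<sigma> \<mu> T \<and>
         (\<nexists>i s'. best_response_step \<epsilon> A v B m i (\<sigma> T) s') \<longrightarrow>
         pure_nash \<epsilon> A v B m (\<sigma> T) \<and>
         (\<forall>i<length v. buyer_utility A v B m v i \<le> buyer_utility A v B m (\<sigma> T) i) \<and>
         (\<forall>i<length v. \<not> (T > 0 \<and> i = \<mu> (T - 1)) \<longrightarrow>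
            units A B m v i \<le> units A B m (\<sigma> T) i))"
      by (intro conjI best_response_converges_truthful allI impI; elim conjE)
        (rule terminal_profile; assumption)+
  qed
next
  show "\<exists>A v B m s\<^sub>0 \<sigma> \<mu> T.
      envy_free_mechanism \<epsilon> \<delta> A \<and> is_market \<epsilon> v B \<and>
      is_profile \<epsilon> v s\<^sub>0 \<and> s\<^sub>0 \<noteq> v \<and>
      T > 0 \<and> best_response_run \<epsilon> A v B m s\<^sub>0 \<sigma> \<mu> T \<and> \<sigma> T = s\<^sub>0"
    using assms by (rule best_response_cycle)
qed

end
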